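(* Let $G$ be a countably infinite discrete amenable group acting on a compact metrizable finite-dimensional space $X$. If the action $G\curvearrowright X$ is essentially free, then it has the small boundary property.
   Context: $M_G(X)$ denotes the set of $G$-invariant Borel probability measures on $X$. The action is essentially free if for every $g\in G\setminus\{1\}$ and every $\mu\in M_G(X)$ one has $\mu(\{x\in X: g\cdot x=x\})=0$. It has the small boundary property if $X$ admits a basis for its topology consisting of (open) sets $U\subseteq X$ with $\mu(\partial U)=0$ for all $\mu\in M_G(X)$. Finite-dimensional refers to the covering dimension. *)

theory Defs
  imports "HOL-Probability.Probability" "HOL-Algebra.Group_Action"
begin

text \<open>Amenability of a discrete group, as existence of a left-invariant finitely additive
  probability measure on all subsets. The values of \<open>m\<close> off subsets of the carrier are irrelevant.\<close>

definition amenable :: "('g, 'b) monoid_scheme \<Rightarrow> bool" where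
  "amenable G \<longleftrightarrow> (\<exists>m :: 'g set \<Rightarrow> real.
     (\<forall>A. A \<subseteq> carrier G \<longrightarrow> 0 \<le> m A) \<and>
     m (carrier G) = 1 \<and>
     (\<forall>A B. A \<subseteq> carrier G \<longrightarrow> B \<subseteq> carrier G \<longrightarrow> A \<inter> B = {} \<longrightarrow> m (A \<union> B) = m A + m B) \<and>
     (\<forall>g\<in>carrier G. \<forall>A. A \<subseteq> carrier G \<longrightarrow> m (g <#\<^bsub>G\<^esub> A) = m A))"

text \<open>Covering dimension at most \<open>n\<close>: every finite open cover has a finite open refinement
  covering the space in which no point lies in more than \<open>n + 1\<close> members.\<close>

definition covering_dim_le :: "'x topology \<Rightarrow> nat \<Rightarrow> bool" where
  "covering_dim_le X n \<longleftrightarrow>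
     (\<forall>\<U>. finite \<U> \<longrightarrow> (\<forall>U\<in>\<U>. openin X U) \<longrightarrow> \<Union>\<U> = topspace X \<longrightarrow>
        (\<exists>\<V>. finite \<V> \<and> (\<forall>V\<in>\<V>. openin X V) \<and> \<Union>\<V> = topspace X \<and>
             (\<forall>V\<in>\<V>. \<exists>U\<in>\<U>. V \<subseteq> U) \<and>
             (\<forall>x\<in>topspace X. card {V \<in> \<V>. x \<in> V} \<le> n + 1)))"

definition finite_dimensional_space :: "'x topology \<Rightarrow> bool" where
  "finite_dimensional_space X \<longleftrightarrow> (\<exists>n. covering_dim_le X n)"

text \<open>Since \<open>G\<close> is discrete, joint continuity amounts to each group element acting by a
  homeomorphism.\<close>

definition continuous_action ::
  "('g, 'b) monoid_scheme \<Rightarrow> 'x topology \<Rightarrow> ('g \<Rightarrow> 'x \<Rightarrow> 'x) \<Rightarrow> bool" where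
  "continuous_action G X \<phi> \<longleftrightarrow>
     group_action G (topspace X) \<phi> \<and> (\<forall>g\<in>carrier G. homeomorphic_map X X (\<phi> g))"

definition borel_sigma :: "'x topology \<Rightarrow> 'x measure" where
  "borel_sigma X = sigma (topspace X) {U. openin X U}"

definition invariant_prob_measures ::
  "('g, 'b) monoid_scheme \<Rightarrow> 'x topology \<Rightarrow> ('g \<Rightarrow> 'x \<Rightarrow> 'x) \<Rightarrow> 'x measure set" where
  "invariant_prob_measures G X \<phi> =
     {\<mu>. prob_space \<mu> \<and> sets \<mu> = sets (borel_sigma X) \<and>
         (\<forall>g\<in>carrier G. distr \<mu> \<mu> (\<phi> g) = \<mu>)}"

definition essentially_free ::
  "('g, 'b) monoid_scheme \<Rightarrow> 'x topology \<Rightarrow> ('g \<Rightarrow> 'x \<Rightarrow> 'x) \<Rightarrow> bool" where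
  "essentially_free G X \<phi> \<longleftrightarrow>
     (\<forall>g\<in>carrier G - {\<one>\<^bsub>G\<^esub>}. \<forall>\<mu>\<in>invariant_prob_measures G X \<phi>.
        measure \<mu> {x \<in> topspace X. \<phi> g x = x} = 0)"

definition small_boundary_property ::
  "('g, 'b) monoid_scheme \<Rightarrow> 'x topology \<Rightarrow> ('g \<Rightarrow> 'x \<Rightarrow> 'x) \<Rightarrow> bool" where
  "small_boundary_property G X \<phi> \<longleftrightarrow>
     (\<exists>\<B>. openin X = arbitrary union_of (\<lambda>U. U \<in> \<B>) \<and>
          (\<forall>U\<in>\<B>. \<forall>\<mu>\<in>invariant_prob_measures G X \<phi>. measure \<mu> (X frontier_of U) = 0))"

end

theory Submission
  imports Defs
begin

text \<open>
  Let \<open>n\<close> bound the covering dimension of \<open>X\<close>. The base consists of sublevel sets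
  \<open>{f < 0}\<close> of continuous functions that are generic in the following sense: whenever
  \<open>n + 1\<close> group elements move a point \<open>x\<close> to \<open>n + 1\<close> distinct points, \<open>f\<close>
  does not vanish at all of these.

  Such functions have null zero sets \<open>Z\<close> (\<open>level_set_null\<close>). For an invariant
  probability measure, essential freeness says that almost every \<open>x\<close> has pairwise distinct
  translates under distinct group elements. So almost every \<open>x\<close> lies in at most \<open>n\<close> of the
  preimages of \<open>Z\<close> under any \<open>m\<close> group elements. Each preimage has the measure of \<open>Z\<close>, hence
  \<open>m\<close> times that measure is at most \<open>n\<close>, for every \<open>m\<close>. The boundary of \<open>{f < 0}\<close> lies
  in \<open>Z\<close>.

  Generic functions are dense (\<open>generic_function_nonvanishing_along_orbits\<close>) by the Baire
  category theorem, and density is where the dimension enters. Near a point with distinct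
  translates \<open>g x\<close>, for \<open>g\<close> in a set \<open>A\<close> of size \<open>n + 1\<close>, the values of
  \<open>f\<close> at the translates can be changed independently of each other. So all that is needed is to
  move a map from \<open>X\<close> to \<open>\<real>\<^sup>n\<^sup>+\<^sup>1\<close> slightly off the origin
  (\<open>nonvanishing_approximation\<close>). This is possible since the map is close to
  one that factors through the nerve of a cover of multiplicity at most \<open>n + 1\<close>, where the
  images of the vertices can be taken in general position.
\<close>

section \<open>Vectors in general position\<close>

text \<open>Gaussian elimination, one equation at a time. Read dually, fewer than \<open>card I\<close> vectors
  in \<open>\<real>\<^sup>I\<close> lie on a common hyperplane through the origin. Vectors are functions
  on an index set, since the dimension is one more than the covering dimension and so cannot be
  a type.\<close>

lemma homogeneous_system_nontrivial_solution:
  fixes v :: "'a \<Rightarrow> 'i \<Rightarrow> real"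
  assumes "finite S" and "finite I" and "card S < card I"
  shows "\<exists>l. (\<exists>i\<in>I. l i \<noteq> 0) \<and> (\<forall>s\<in>S. (\<Sum>i\<in>I. l i * v s i) = 0)"
  using assms
proof (induction S arbitrary: I v rule: finite_induct)
  case empty
  then have "I \<noteq> {}" by auto
  then show ?case by (intro exI[of _ "\<lambda>_. 1"]) auto
next
  case (insert t S)
  have card: "card S < card I - 1" using insert by simp
  show ?case
  proof (cases "\<forall>i\<in>I. v t i = 0")
    case True
    obtain l where "\<exists>i\<in>I. l i \<noteq> 0" "\<forall>s\<in>S. (\<Sum>i\<in>I. l i * v s i) = 0"
      using insert.IH[of I v] insert.prems(1) card by (meson diff_le_self less_le_trans)
    with True show ?thesis by (intro exI[of _ l]) auto
  next
    case False
    then obtain j where j: "j \<in> I" "v t j \<noteq> 0" by blast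
    let ?J = "I - {j}"
    define w where "w s i = v s i - v s j / v t j * v t i" for s i
    obtain l where l: "\<exists>i\<in>?J. l i \<noteq> 0" "\<forall>s\<in>S. (\<Sum>i\<in>?J. l i * w s i) = 0"
      using insert.IH[of ?J w] insert.prems card j by auto
    \<comment> \<open>Solve equation \<open>t\<close> for the pivot coordinate \<open>j\<close>.\<close>
    define m where "m = l(j := - (\<Sum>i\<in>?J. l i * v t i) / v t j)"
    have split: "(\<Sum>i\<in>I. m i * v s i) = m j * v s j + (\<Sum>i\<in>?J. l i * v s i)" for s
      using insert.prems(1) j by (simp add: sum.remove[of I j] m_def)
    have t: "(\<Sum>i\<in>I. m i * v t i) = 0"
      using j by (simp add: split) (simp add: m_def)
    have "(\<Sum>i\<in>I. m i * v s i) = 0" if "s \<in> S" for s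
    proof -
      have "0 = (\<Sum>i\<in>?J. l i * v s i) - v s j / v t j * (\<Sum>i\<in>?J. l i * v t i)"
        using l(2) that by (simp add: w_def right_diff_distrib sum_subtractf sum_distrib_left mult_ac)
      then show ?thesis
        using j by (simp add: split) (simp add: m_def field_simps)
    qed
    with t have "\<forall>s\<in>insert t S. (\<Sum>i\<in>I. m i * v s i) = 0" by blast
    moreover have "\<exists>i\<in>I. m i \<noteq> 0" using l(1) by (auto simp: m_def)
    ultimately show ?thesis by blast
  qed
qed

text \<open>Move \<open>p\<close> along a curve with distinct powers of \<open>s\<close> as coordinates:
  on the curve each functional \<open>l\<close> is a nonzero polynomial in \<open>s\<close>, so all but finitely many
  small \<open>s > 0\<close> avoid all the hyperplanes at once.\<close>

lemma small_vector_off_hyperplanes: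
  fixes p :: "'i \<Rightarrow> real" and L :: "('i \<Rightarrow> real) set"
  assumes "finite I" and "finite L" and "\<And>l. l \<in> L \<Longrightarrow> \<exists>i\<in>I. l i \<noteq> 0" and "0 < \<epsilon>"
  shows "\<exists>q. (\<forall>i\<in>I. \<bar>q i - p i\<bar> < \<epsilon>) \<and> (\<forall>l\<in>L. (\<Sum>i\<in>I. l i * q i) \<noteq> 0)"
proof -
  obtain e :: "'i \<Rightarrow> nat" where e: "inj_on e I"
    using finite_imp_inj_to_nat_seg[OF assms(1)] by blast
  define P where "P l = [:\<Sum>i\<in>I. l i * p i:] + (\<Sum>i\<in>I. monom (l i) (Suc (e i)))" for l
  have P: "poly (P l) s = (\<Sum>i\<in>I. l i * (p i + s ^ Suc (e i)))" for l s
    by (simp add: P_def poly_sum poly_monom sum.distrib distrib_left del: power_Suc)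
  \<comment> \<open>The \<open>e i + 1\<close>-st coefficient is \<open>l i\<close>; the shift by one keeps it apart from the constant term.\<close>
  have nz: "P l \<noteq> 0" if lL: "l \<in> L" for l
  proof -
    obtain i where i: "i \<in> I" "l i \<noteq> 0" using assms(3)[OF lL] by blast
    have "coeff (P l) (Suc (e i)) = (\<Sum>j\<in>I. if j = i then l j else 0)"
      unfolding P_def using e i(1)
      by (auto simp: coeff_sum inj_on_eq_iff intro!: sum.cong)
    with i assms(1) show ?thesis by auto
  qed
  have "finite (\<Union>l\<in>L. {s. poly (P l) s = 0})"
    using assms(2) nz poly_roots_finite by blast
  moreover have "infinite {0<..<min 1 \<epsilon>}" using assms(4) by (intro infinite_Ioo) simp
  ultimately have "\<not> {0<..<min 1 \<epsilon>} \<subseteq> (\<Union>l\<in>L. {s. poly (P l) s = 0})"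
    using finite_subset by blast
  then obtain s where s: "s \<in> {0<..<min 1 \<epsilon>}" "\<forall>l\<in>L. poly (P l) s \<noteq> 0"
    by blast
  have "s ^ Suc k \<le> s" for k
    using s(1) power_le_one[of s k] by (simp add: mult_left_le)
  then have "\<bar>(p i + s ^ Suc (e i)) - p i\<bar> < \<epsilon>" for i
    using s(1) by (smt (verit) greaterThanLessThan_iff zero_less_power min_less_iff_conj)
  then show ?thesis
    using s(2) unfolding P by (intro exI[of _ "\<lambda>i. p i + s ^ Suc (e i)"]) blast
qed

text \<open>The vectors are chosen one after the other, each off finitely many
  hyperplanes, one through every set of fewer than \<open>card I\<close> of its predecessors.
  This is what makes the nerve map below miss the origin.\<close>

lemma general_position_perturbation:
  fixes p :: "'a \<Rightarrow> 'i \<Rightarrow> real"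
  assumes "finite S" and "finite I" and "0 < \<epsilon>"
  shows "\<exists>q. (\<forall>s\<in>S. \<forall>i\<in>I. \<bar>q s i - p s i\<bar> < \<epsilon>) \<and>
    (\<forall>T c. T \<subseteq> S \<longrightarrow> card T \<le> card I \<longrightarrow> (\<forall>i\<in>I. (\<Sum>s\<in>T. c s * q s i) = 0) \<longrightarrow> (\<forall>s\<in>T. c s = 0))"
  using assms(1)
proof (induction S rule: finite_induct)
  case (insert t S)
  then obtain q where q: "\<forall>s\<in>S. \<forall>i\<in>I. \<bar>q s i - p s i\<bar> < \<epsilon>"
    and indep: "\<And>T c. T \<subseteq> S \<Longrightarrow> card T \<le> card I \<Longrightarrow> (\<forall>i\<in>I. (\<Sum>s\<in>T. c s * q s i) = 0)
      \<Longrightarrow> \<forall>s\<in>T. c s = (0::real)"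
    by (auto 0 3)
  let ?\<T> = "{T. T \<subseteq> S \<and> card T < card I}"
  have "\<forall>T\<in>?\<T>. \<exists>l. (\<exists>i\<in>I. l i \<noteq> 0) \<and> (\<forall>s\<in>T. (\<Sum>i\<in>I. l i * q s i) = 0)"
    using finite_subset[OF _ insert.hyps(1)]
    by (intro ballI homogeneous_system_nontrivial_solution assms(2)) auto
  then obtain l where l: "\<And>T. T \<in> ?\<T> \<Longrightarrow> \<exists>i\<in>I. l T i \<noteq> 0"
    "\<And>T s. T \<in> ?\<T> \<Longrightarrow> s \<in> T \<Longrightarrow> (\<Sum>i\<in>I. l T i * q s i) = 0"
    unfolding bchoice_iff by auto
  have "finite (l ` ?\<T>)" using insert.hyps(1) by simp
  then have "\<exists>r. (\<forall>i\<in>I. \<bar>r i - p t i\<bar> < \<epsilon>) \<and> (\<forall>m\<in>l ` ?\<T>. (\<Sum>i\<in>I. m i * r i) \<noteq> 0)"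
    using l(1) assms(2,3) by (intro small_vector_off_hyperplanes) auto
  then obtain r where r: "\<forall>i\<in>I. \<bar>r i - p t i\<bar> < \<epsilon>"
    and "\<forall>m\<in>l ` ?\<T>. (\<Sum>i\<in>I. m i * r i) \<noteq> 0"
    by blast
  then have r': "(\<Sum>i\<in>I. l T i * r i) \<noteq> 0" if "T \<in> ?\<T>" for T
    using that by blast
  define q' where "q' = q(t := r)"
  have q'S: "q' s = q s" if "s \<in> S" for s using that insert.hyps(2) by (auto simp: q'_def)
  have "\<forall>s\<in>T. c s = 0"
    if T: "T \<subseteq> insert t S" "card T \<le> card I" and 0: "\<forall>i\<in>I. (\<Sum>s\<in>T. c s * q' s i) = 0" for T c
  proof (cases "t \<in> T")
    case False
    with T have "T \<subseteq> S" by blast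
    with 0 have "\<forall>i\<in>I. (\<Sum>s\<in>T. c s * q s i) = 0"
      using q'S by (simp add: subset_iff cong: sum.cong)
    with indep T \<open>T \<subseteq> S\<close> show ?thesis by blast
  next
    case True
    let ?R = "T - {t}"
    have fin: "finite T" using T insert.hyps(1) finite_subset by blast
    have R: "?R \<subseteq> S" "?R \<in> ?\<T>"
      using T True fin card_Diff1_less[of T t] by auto
    have split: "(\<Sum>s\<in>T. c s * q' s i) = c t * r i + (\<Sum>s\<in>?R. c s * q s i)" for i
    proof -
      have "(\<Sum>s\<in>?R. c s * q' s i) = (\<Sum>s\<in>?R. c s * q s i)"
        using R(1) q'S by (intro sum.cong) auto
      then show ?thesis using fin True by (simp add: sum.remove[of T t] q'_def)
    qed
    \<comment> \<open>The functional \<open>l ?R\<close> annihilates every vector of the relation except \<open>r\<close>.\<close>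
    have "0 = (\<Sum>i\<in>I. l ?R i * (c t * r i + (\<Sum>s\<in>?R. c s * q s i)))"
      using 0 by (simp add: split)
    also have "\<dots> = c t * (\<Sum>i\<in>I. l ?R i * r i) + (\<Sum>i\<in>I. \<Sum>s\<in>?R. c s * (l ?R i * q s i))"
      by (simp add: distrib_left sum.distrib sum_distrib_left mult_ac)
    also have "(\<Sum>i\<in>I. \<Sum>s\<in>?R. c s * (l ?R i * q s i)) = (\<Sum>s\<in>?R. c s * (\<Sum>i\<in>I. l ?R i * q s i))"
      by (subst sum.swap) (simp add: sum_distrib_left)
    also have "\<dots> = 0" using l(2)[OF R(2)] by simp
    finally have "c t = 0" using r'[OF R(2)] by simp
    with 0 have "\<forall>i\<in>I. (\<Sum>s\<in>?R. c s * q s i) = 0" by (simp add: split)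
    moreover have "card ?R \<le> card I" using R(2) by simp
    ultimately have "\<forall>s\<in>?R. c s = 0" by (intro indep R(1))
    with \<open>c t = 0\<close> show ?thesis by blast
  qed
  moreover have "\<forall>s\<in>insert t S. \<forall>i\<in>I. \<bar>q' s i - p s i\<bar> < \<epsilon>"
    using q r by (simp add: q'_def)
  ultimately show ?case by blast
qed auto

section \<open>Maps into the nerve of a cover\<close>

lemma compactin_positive_lower_bound:
  fixes p :: "'x \<Rightarrow> real"
  assumes "compactin X K" and "continuous_map X euclideanreal p" and "\<And>x. x \<in> K \<Longrightarrow> 0 < p x"
  shows "\<exists>\<delta>>0. \<forall>x\<in>K. \<delta> \<le> p x"
proof (cases "K = {}")
  case False
  have "compact (p ` K)"
    using image_compactin[OF assms(1,2)] by simp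
  then obtain y where "y \<in> p ` K" "\<forall>z\<in>p ` K. y \<le> z"
    using compact_attains_inf[of "p ` K"] False by auto
  then show ?thesis using assms(3) by auto
qed (auto intro: exI[of _ 1])

text \<open>The closed balls of radius \<open>1 / (k + 1)\<close> about the points of a finite
  \<open>1 / (k + 1)\<close>-net, for all \<open>k\<close>. These sets make the number of conditions in the
  category argument countable.\<close>

lemma compact_metrizable_countable_closed_neighbourhoods:
  assumes "compact_space X" and "metrizable_space X"
  shows "\<exists>\<K>. countable \<K> \<and> (\<forall>K\<in>\<K>. closedin X K) \<and>
    (\<forall>U x. openin X U \<longrightarrow> x \<in> U \<longrightarrow> (\<exists>K\<in>\<K>. x \<in> K \<and> K \<subseteq> U))"
proof -
  obtain M d where "Metric_space M d" and X: "X = Metric_space.mtopology M d"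
    using assms(2) unfolding metrizable_space_def by blast
  interpret Metric_space M d by fact
  have "mtotally_bounded M"
    using assms(1) compactin_imp_mtotally_bounded by (simp add: X compact_space_def)
  then have "\<forall>k::nat. \<exists>S. finite S \<and> S \<subseteq> M \<and> M \<subseteq> (\<Union>c\<in>S. mball c (1 / real (Suc k)))"
    unfolding mtotally_bounded_def by simp
  then obtain S where S: "\<And>k. finite (S k)" "\<And>k. M \<subseteq> (\<Union>c\<in>S k. mball c (1 / real (Suc k)))"
    by metis
  define \<K> where "\<K> = (\<Union>k. (\<lambda>c. mcball c (1 / real (Suc k))) ` S k)"
  have "countable \<K>" unfolding \<K>_def using S(1) by (intro countable_UN countable_image) (auto intro: countable_finite)
  moreover have "\<forall>K\<in>\<K>. closedin X K" by (auto simp: \<K>_def X)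
  moreover have "\<exists>K\<in>\<K>. x \<in> K \<and> K \<subseteq> U" if U: "openin X U" "x \<in> U" for U x
  proof -
    obtain r where r: "r > 0" "mball x r \<subseteq> U" and xM: "x \<in> M"
      using U unfolding X openin_mtopology by blast
    obtain k where k: "1 / real (Suc k) < r / 2"
      using reals_Archimedean[of "r / 2"] r(1) by (auto simp: inverse_eq_divide)
    obtain c where c: "c \<in> S k" "x \<in> mball c (1 / real (Suc k))" using S(2)[of k] xM by blast
    have "mcball c (1 / real (Suc k)) \<subseteq> mball x r"
    proof
      fix y assume y: "y \<in> mcball c (1 / real (Suc k))"
      have "d x y \<le> d x c + d c y" using y c(2) by (intro triangle) auto
      also have "\<dots> < r" using y c(2) k commute by (smt (verit) field_sum_of_halves in_mball in_mcball)
      finally show "y \<in> mball x r" using y xM by simp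
    qed
    then show ?thesis using c r(2) unfolding \<K>_def by (intro bexI[of _ "mcball c (1 / real (Suc k))"]) auto
  qed
  ultimately show ?thesis by blast
qed

text \<open>The function is the distance to the complement of \<open>U\<close>.\<close>

lemma metrizable_openin_cozero:
  assumes "metrizable_space X" and "openin X U"
  shows "\<exists>w. continuous_map X euclideanreal w \<and> (\<forall>x\<in>topspace X. 0 \<le> w x \<and> (0 < w x \<longleftrightarrow> x \<in> U))"
proof -
  obtain M d where "Metric_space M d" and X: "X = Metric_space.mtopology M d"
    using assms(1) unfolding metrizable_space_def by blast
  interpret Metric_space M d by fact
  show ?thesis
  proof (cases "M \<subseteq> U")
    case True
    \<comment> \<open>There is no complement to measure the distance to.\<close>
    then show ?thesis by (intro exI[of _ "\<lambda>_. 1"]) (auto simp: X)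
  next
    case False
    define C where "C = M - U"
    have C: "C \<noteq> {}" "C \<subseteq> M" using False by (auto simp: C_def)
    define w where "w x = (INF c\<in>C. d x c)" for x
    have bdd: "bdd_below (d x ` C)" for x by (rule bdd_belowI[of _ 0]) auto
    have lip: "w x \<le> w y + d x y" if "x \<in> M" "y \<in> M" for x y
    proof -
      have "w x - d x y \<le> d y c" if "c \<in> C" for c
        using cINF_lower[OF bdd[of x] that] triangle[of x y c] that C(2) \<open>x \<in> M\<close> \<open>y \<in> M\<close>
        unfolding w_def by fastforce
      then have "w x - d x y \<le> w y" unfolding w_def[of y] by (intro cINF_greatest C)
      then show ?thesis by simp
    qed
    have "Lipschitz_continuous_map Self euclidean_metric w"
      unfolding Lipschitz_continuous_map_def
    proof (intro conjI exI[of _ 1] ballI)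
      fix x y assume "x \<in> mspace Self" "y \<in> mspace Self"
      then show "mdist euclidean_metric (w x) (w y) \<le> 1 * mdist Self x y"
        using lip[of x y] lip[of y x] commute[of x y] by (simp add: dist_real_def)
    qed auto
    then have cont: "continuous_map X euclideanreal w"
      using Lipschitz_continuous_imp_continuous_map[of Self euclidean_metric w] by (simp add: X Self_def)
    have nonneg: "0 \<le> w x" for x unfolding w_def by (intro cINF_greatest C) auto
    have "0 < w x \<longleftrightarrow> x \<in> U" if x: "x \<in> M" for x
    proof
      assume "x \<in> U"
      then obtain r where r: "r > 0" "mball x r \<subseteq> U"
        using assms(2) unfolding X openin_mtopology by blast
      have "r \<le> d x c" if "c \<in> C" for c
        using r(2) that x C(2) unfolding C_def by (metis DiffD2 DiffD1 in_mball not_less subsetD that C_def)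
      then have "r \<le> w x" unfolding w_def by (intro cINF_greatest C)
      with r(1) show "0 < w x" by simp
    next
      assume "0 < w x"
      show "x \<in> U"
      proof (rule ccontr)
        assume "x \<notin> U"
        then have "w x \<le> d x x" using x unfolding w_def by (intro cINF_lower bdd) (simp add: C_def)
        then show False using x \<open>0 < w x\<close> by simp
      qed
    qed
    then show ?thesis using cont nonneg by (auto simp: X)
  qed
qed

lemma metrizable_partition_of_unity:
  assumes "metrizable_space X" and "finite \<V>" and "\<And>V. V \<in> \<V> \<Longrightarrow> openin X V"
    and "\<Union>\<V> = topspace X"
  shows "\<exists>u. (\<forall>V\<in>\<V>. continuous_map X euclideanreal (u V)) \<and>
    (\<forall>x\<in>topspace X. (\<forall>V\<in>\<V>. 0 \<le> u V x \<and> (0 < u V x \<longleftrightarrow> x \<in> V)) \<and> (\<Sum>V\<in>\<V>. u V x) = (1::real))"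
proof -
  have "\<forall>V\<in>\<V>. \<exists>w. continuous_map X euclideanreal w \<and> (\<forall>x\<in>topspace X. 0 \<le> w x \<and> (0 < w x \<longleftrightarrow> x \<in> V))"
    using metrizable_openin_cozero assms(1,3) by blast
  then obtain w where w: "\<And>V. V \<in> \<V> \<Longrightarrow> continuous_map X euclideanreal (w V)"
    "\<And>V x. V \<in> \<V> \<Longrightarrow> x \<in> topspace X \<Longrightarrow> 0 \<le> w V x"
    "\<And>V x. V \<in> \<V> \<Longrightarrow> x \<in> topspace X \<Longrightarrow> 0 < w V x \<longleftrightarrow> x \<in> V"
    by metis
  have pos: "0 < (\<Sum>V\<in>\<V>. w V x)" if x: "x \<in> topspace X" for x
  proof -
    obtain V where "V \<in> \<V>" "x \<in> V" using assms(4) x by blast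
    then show ?thesis using w x assms(2) by (intro sum_pos2[of _ V]) auto
  qed
  define u where "u V x = w V x / (\<Sum>V\<in>\<V>. w V x)" for V x
  have "continuous_map X euclideanreal (u V)" if "V \<in> \<V>" for V
    unfolding u_def using w(1) that assms(2) pos by (intro continuous_intros) force+
  moreover have "(\<Sum>V\<in>\<V>. u V x) = 1" if "x \<in> topspace X" for x
    using pos[OF that] by (simp add: u_def flip: sum_divide_distrib)
  moreover have "0 \<le> u V x \<and> (0 < u V x \<longleftrightarrow> x \<in> V)" if "x \<in> topspace X" "V \<in> \<V>" for x V
    using pos[OF that(1)] w that by (auto simp: u_def zero_less_divide_iff)
  ultimately show ?thesis by blast
qed

text \<open>A map from an \<open>n\<close>-dimensional space to \<open>\<real>\<^sup>n\<^sup>+\<^sup>1\<close> can be moved off the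
  origin by an arbitrarily small perturbation. Take a cover of multiplicity at most \<open>n + 1\<close>
  on whose members \<open>F\<close> hardly varies, pick for each member \<open>V\<close> a vector \<open>q V\<close> close to the
  values of \<open>F\<close> on \<open>V\<close>, with the \<open>q V\<close> in general position, and interpolate by a
  partition of unity. A value of the interpolation is a nontrivial combination of at most
  \<open>n + 1\<close> of the \<open>q V\<close>, which are linearly independent.\<close>

lemma nonvanishing_approximation:
  fixes F :: "'i \<Rightarrow> 'x \<Rightarrow> real"
  assumes "compact_space X" and "metrizable_space X" and "covering_dim_le X n"
    and "finite I" and "card I = Suc n"
    and "\<And>i. i \<in> I \<Longrightarrow> continuous_map X euclideanreal (F i)" and "0 < \<epsilon>"
  shows "\<exists>H. (\<forall>i\<in>I. continuous_map X euclideanreal (H i)) \<and>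
    (\<forall>x\<in>topspace X. (\<forall>i\<in>I. \<bar>H i x - F i x\<bar> < \<epsilon>) \<and> (\<exists>i\<in>I. H i x \<noteq> 0))"
proof -
  define U where "U x = {y \<in> topspace X. (\<Sum>i\<in>I. \<bar>F i y - F i x\<bar>) \<in> {..<\<epsilon>/4}}" for x
  have "openin X (U x)" for x
    unfolding U_def using assms(4,6)
    by (intro openin_continuous_map_preimage[of X euclideanreal] continuous_intros) auto
  moreover have "\<Union>(U ` topspace X) = topspace X"
    using assms(7) by (force simp: U_def)
  ultimately obtain \<U> where \<U>: "finite \<U>" "\<U> \<subseteq> U ` topspace X" "\<Union>\<U> = topspace X"
    using assms(1)[unfolded compact_space, rule_format, of "U ` topspace X"] by auto
  then have "\<forall>W\<in>\<U>. openin X W" using \<open>\<And>x. openin X (U x)\<close> by blast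
  with \<U>(1,3) have "\<exists>\<V>. finite \<V> \<and> (\<forall>V\<in>\<V>. openin X V) \<and> \<Union>\<V> = topspace X \<and>
      (\<forall>V\<in>\<V>. \<exists>W\<in>\<U>. V \<subseteq> W) \<and> (\<forall>x\<in>topspace X. card {V \<in> \<V>. x \<in> V} \<le> n + 1)"
    using assms(3) unfolding covering_dim_le_def by blast
  then obtain \<V> where \<V>: "finite \<V>" "\<forall>V\<in>\<V>. openin X V" "\<Union>\<V> = topspace X"
    and refines: "\<forall>V\<in>\<V>. \<exists>W\<in>\<U>. V \<subseteq> W"
    and mult: "\<forall>x\<in>topspace X. card {V \<in> \<V>. x \<in> V} \<le> n + 1"
    by (elim exE conjE) (rule that)
  \<comment> \<open>Empty members are dropped so that every remaining one has a sample point.\<close>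
  define \<W> where "\<W> = \<V> - {{}}"
  have \<W>: "finite \<W>" "\<And>V. V \<in> \<W> \<Longrightarrow> openin X V" "\<Union>\<W> = topspace X"
    using \<V> by (auto simp: \<W>_def)
  have "\<forall>V\<in>\<W>. \<exists>x. x \<in> V" by (auto simp: \<W>_def)
  then obtain a where a: "\<And>V. V \<in> \<W> \<Longrightarrow> a V \<in> V" by metis
  have osc: "\<bar>F i (a V) - F i x\<bar> < \<epsilon>/2" if "V \<in> \<W>" "x \<in> V" "i \<in> I" for V x i
  proof -
    have "V \<in> \<V>" using that(1) by (simp add: \<W>_def)
    then obtain W where "W \<in> \<U>" "V \<subseteq> W" using bspec[OF refines] by blast
    moreover from this obtain z where "W = U z" using \<U>(2) by auto
    ultimately have z: "V \<subseteq> U z" by simp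
    have "\<bar>F i y - F i z\<bar> < \<epsilon>/4" if "y \<in> V" for y
      using z that member_le_sum[OF \<open>i \<in> I\<close>, of "\<lambda>i. \<bar>F i y - F i z\<bar>"] assms(4) by (auto simp: U_def)
    from this[OF a[OF that(1)]] this[OF that(2)] show ?thesis by linarith
  qed
  have "0 < \<epsilon>/4" using assms(7) by simp
  from general_position_perturbation[OF \<W>(1) assms(4) this, of "\<lambda>V i. F i (a V)"]
  obtain q where q: "\<forall>V\<in>\<W>. \<forall>i\<in>I. \<bar>q V i - F i (a V)\<bar> < \<epsilon>/4"
    and indep: "\<forall>T c. T \<subseteq> \<W> \<longrightarrow> card T \<le> card I \<longrightarrow> (\<forall>i\<in>I. (\<Sum>V\<in>T. c V * q V i) = 0)
      \<longrightarrow> (\<forall>V\<in>T. c V = 0)"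
    by (elim exE conjE) (rule that)
  obtain u where u: "\<And>V. V \<in> \<W> \<Longrightarrow> continuous_map X euclideanreal (u V)"
    "\<And>V x. V \<in> \<W> \<Longrightarrow> x \<in> topspace X \<Longrightarrow> 0 \<le> u V x"
    "\<And>V x. V \<in> \<W> \<Longrightarrow> x \<in> topspace X \<Longrightarrow> 0 < u V x \<longleftrightarrow> x \<in> V"
    "\<And>x. x \<in> topspace X \<Longrightarrow> (\<Sum>V\<in>\<W>. u V x) = 1"
    using metrizable_partition_of_unity[OF assms(2) \<W>] by metis
  define H where "H i x = (\<Sum>V\<in>\<W>. u V x * q V i)" for i x
  have "continuous_map X euclideanreal (H i)" for i
    unfolding H_def using u(1) \<W>(1) by (intro continuous_intros) auto
  moreover have "\<bar>H i x - F i x\<bar> < \<epsilon>" if x: "x \<in> topspace X" and i: "i \<in> I" for x i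
  proof -
    have "u V x * \<bar>q V i - F i x\<bar> \<le> u V x * (3/4 * \<epsilon>)" if V: "V \<in> \<W>" for V
    proof (cases "x \<in> V")
      case True
      have "\<bar>q V i - F i x\<bar> \<le> 3/4 * \<epsilon>" using osc[OF V True i] bspec[OF bspec[OF q V] i] by linarith
      then show ?thesis using u(2)[OF V x] by (rule mult_left_mono)
    next
      case False
      then have "u V x = 0" using u(2,3)[OF V x] by simp
      then show ?thesis by simp
    qed
    then have "(\<Sum>V\<in>\<W>. u V x * \<bar>q V i - F i x\<bar>) \<le> (\<Sum>V\<in>\<W>. u V x * (3/4 * \<epsilon>))"
      by (rule sum_mono)
    also have "\<dots> = 3/4 * \<epsilon>" using u(4)[OF x] by (simp only: sum_distrib_right[symmetric] mult_1)
    finally have "(\<Sum>V\<in>\<W>. u V x * \<bar>q V i - F i x\<bar>) \<le> 3/4 * \<epsilon>" .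
    moreover have "H i x - F i x = (\<Sum>V\<in>\<W>. u V x * (q V i - F i x))"
      using u(4)[OF x] by (simp add: H_def right_diff_distrib sum_subtractf flip: sum_distrib_right)
    moreover have "\<bar>\<Sum>V\<in>\<W>. u V x * (q V i - F i x)\<bar> \<le> (\<Sum>V\<in>\<W>. u V x * \<bar>q V i - F i x\<bar>)"
      using sum_abs[of "\<lambda>V. u V x * (q V i - F i x)" \<W>] u(2)[OF _ x] by (simp add: abs_mult)
    ultimately show ?thesis using assms(7) by linarith
  qed
  moreover have "\<exists>i\<in>I. H i x \<noteq> 0" if x: "x \<in> topspace X" for x
  proof (rule ccontr)
    assume neg: "\<not> (\<exists>i\<in>I. H i x \<noteq> 0)"
    let ?T = "{V \<in> \<W>. x \<in> V}"
    have out: "u V x = 0" if "V \<in> \<W> - ?T" for V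
      using u(2,3)[of V x] x that by auto
    have "card ?T \<le> card {V \<in> \<V>. x \<in> V}" using \<V>(1) by (intro card_mono) (auto simp: \<W>_def)
    then have "card ?T \<le> card I" using bspec[OF mult x] assms(5) by simp
    moreover have "(\<Sum>V\<in>?T. u V x * q V i) = 0" if "i \<in> I" for i
    proof -
      have "(\<Sum>V\<in>?T. u V x * q V i) = H i x"
        unfolding H_def using \<W>(1) out by (intro sum.mono_neutral_left) auto
      then show ?thesis using neg that by simp
    qed
    ultimately have "\<forall>V\<in>?T. u V x = 0" using spec[OF spec[OF indep], of ?T "\<lambda>V. u V x"] by simp
    with out have "(\<Sum>V\<in>\<W>. u V x) = 0" by (intro sum.neutral) blast
    with u(4)[OF x] show False by simp
  qed
  ultimately show ?thesis by blast
qed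

text \<open>The tuple of the functions \<open>f \<circ> \<phi> g\<close>, for \<open>g \<in> A\<close>, is a map to
  \<open>\<real>\<^sup>n\<^sup>+\<^sup>1\<close>, and the previous lemma moves it off the origin. Because the sets
  \<open>\<phi> g ` K\<close> are disjoint, its components can be altered independently: a Urysohn function
  for each of these sets copies the new component \<open>H g\<close> onto it, without disturbing the
  others.\<close>

lemma nonvanishing_along_disjoint_images_approximation:
  fixes \<phi> :: "'i \<Rightarrow> 'x \<Rightarrow> 'x" and f :: "'x \<Rightarrow> real"
  assumes "compact_space X" and "metrizable_space X" and "covering_dim_le X n"
    and "finite A" and "card A = Suc n" and homeo: "\<And>g. g \<in> A \<Longrightarrow> homeomorphic_map X X (\<phi> g)"
    and "closedin X K" and disj: "disjoint_family_on (\<lambda>g. \<phi> g ` K) A"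
    and f: "continuous_map X euclideanreal f" and "0 < \<epsilon>"
  shows "\<exists>h. continuous_map X euclideanreal h \<and> (\<forall>x\<in>topspace X. \<bar>h x - f x\<bar> < \<epsilon>) \<and>
    (\<forall>x\<in>K. \<exists>g\<in>A. h (\<phi> g x) \<noteq> 0)"
proof -
  let ?N = "real (card A)"
  define \<eta> where "\<eta> = \<epsilon> / (?N + 1)"
  have \<eta>: "0 < \<eta>" "?N * \<eta> < \<epsilon>" using assms(10) by (auto simp: \<eta>_def field_simps)
  have \<phi>: "continuous_map X X (\<phi> g)" if "g \<in> A" for g
    using homeo[OF that] by (simp add: homeomorphic_eq_everything_map)
  then have "\<And>g. g \<in> A \<Longrightarrow> continuous_map X euclideanreal (f \<circ> \<phi> g)"
    using f continuous_map_compose by blast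
  then have "\<exists>H. (\<forall>g\<in>A. continuous_map X euclideanreal (H g)) \<and>
      (\<forall>x\<in>topspace X. (\<forall>g\<in>A. \<bar>H g x - (f \<circ> \<phi> g) x\<bar> < \<eta>) \<and> (\<exists>g\<in>A. H g x \<noteq> 0))"
    by (intro nonvanishing_approximation[OF assms(1-5)] \<eta>(1))
  then obtain H where H: "\<And>g. g \<in> A \<Longrightarrow> continuous_map X euclideanreal (H g)"
    "\<And>g x. g \<in> A \<Longrightarrow> x \<in> topspace X \<Longrightarrow> \<bar>H g x - f (\<phi> g x)\<bar> < \<eta>"
    "\<And>x. x \<in> topspace X \<Longrightarrow> \<exists>g\<in>A. H g x \<noteq> 0"
    unfolding o_def by metis
  have "\<forall>g\<in>A. \<exists>\<psi>. homeomorphic_maps X X (\<phi> g) \<psi>"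
    using homeo homeomorphic_map_maps by blast
  then obtain \<psi> where "\<And>g. g \<in> A \<Longrightarrow> homeomorphic_maps X X (\<phi> g) (\<psi> g)"
    by metis
  then have \<psi>: "\<And>g. g \<in> A \<Longrightarrow> continuous_map X X (\<psi> g)"
    "\<And>g x. g \<in> A \<Longrightarrow> x \<in> topspace X \<Longrightarrow> \<psi> g (\<phi> g x) = x"
    "\<And>g x. g \<in> A \<Longrightarrow> x \<in> topspace X \<Longrightarrow> \<phi> g (\<psi> g x) = x"
    unfolding homeomorphic_maps_def by auto
  have closed: "closedin X (\<phi> g ` K)" if "g \<in> A" for g
    using homeo[OF that] assms(7) homeomorphic_imp_closed_map unfolding closed_map_def by blast
  have "\<exists>\<rho>. continuous_map X (top_of_set {0..1::real}) \<rho> \<and> \<rho> ` (\<Union>g'\<in>A - {g}. \<phi> g' ` K) \<subseteq> {0} \<and> \<rho> ` (\<phi> g ` K) \<subseteq> {1}"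
    if g: "g \<in> A" for g
  proof -
    have "closedin X (\<Union>g'\<in>A - {g}. \<phi> g' ` K)"
      using assms(4) closed by (intro closedin_Union) auto
    moreover have "disjnt (\<Union>g'\<in>A - {g}. \<phi> g' ` K) (\<phi> g ` K)"
      using disj g unfolding disjoint_family_on_def disjnt_def by blast
    ultimately show ?thesis
      using Urysohn_lemma[OF metrizable_imp_normal_space[OF assms(2)] _ closed[OF g], of _ 0 1]
      by (metis zero_le_one)
  qed
  then obtain \<rho> where \<rho>: "\<And>g. g \<in> A \<Longrightarrow> continuous_map X (top_of_set {0..1::real}) (\<rho> g)"
    "\<And>g. g \<in> A \<Longrightarrow> \<rho> g ` (\<Union>g'\<in>A - {g}. \<phi> g' ` K) \<subseteq> {0}"
    "\<And>g. g \<in> A \<Longrightarrow> \<rho> g ` (\<phi> g ` K) \<subseteq> {1}"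
    by metis
  have \<rho>_cont: "continuous_map X euclideanreal (\<rho> g)"
    and \<rho>_range: "\<And>x. x \<in> topspace X \<Longrightarrow> 0 \<le> \<rho> g x \<and> \<rho> g x \<le> 1" if "g \<in> A" for g
    using \<rho>(1)[OF that] by (auto simp: continuous_map_in_subtopology)
  define h where "h y = f y + (\<Sum>g\<in>A. \<rho> g y * (H g (\<psi> g y) - f y))" for y
  have H\<psi>: "continuous_map X euclideanreal (\<lambda>y. H g (\<psi> g y))" if "g \<in> A" for g
    using continuous_map_compose[OF \<psi>(1) H(1), OF that that] by (simp add: o_def)
  have "continuous_map X euclideanreal h"
    unfolding h_def using \<rho>_cont H\<psi> f assms(4) by (intro continuous_intros) auto
  moreover have "\<bar>h y - f y\<bar> < \<epsilon>" if y: "y \<in> topspace X" for y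
  proof -
    have "\<bar>\<rho> g y * (H g (\<psi> g y) - f y)\<bar> \<le> \<eta>" if g: "g \<in> A" for g
    proof -
      have "\<psi> g y \<in> topspace X" using \<psi>(1)[OF g] y continuous_map_image_subset_topspace by blast
      then have "\<bar>H g (\<psi> g y) - f y\<bar> \<le> \<eta>"
        using H(2)[OF g] \<psi>(3)[OF g y] by fastforce
      then have "\<bar>\<rho> g y\<bar> * \<bar>H g (\<psi> g y) - f y\<bar> \<le> 1 * \<eta>"
        using \<rho>_range[OF g y] by (intro mult_mono) auto
      then show ?thesis by (simp add: abs_mult)
    qed
    then have "(\<Sum>g\<in>A. \<bar>\<rho> g y * (H g (\<psi> g y) - f y)\<bar>) \<le> ?N * \<eta>"
      by (intro sum_bounded_above)
    then show ?thesis
      using sum_abs[of "\<lambda>g. \<rho> g y * (H g (\<psi> g y) - f y)" A] \<eta>(2) unfolding h_def by linarith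
  qed
  moreover have "\<exists>g\<in>A. h (\<phi> g x) \<noteq> 0" if x: "x \<in> K" for x
  proof -
    have xX: "x \<in> topspace X" using x assms(7) closedin_subset by blast
    then obtain g where g: "g \<in> A" "H g x \<noteq> 0" using H(3) by blast
    have 1: "\<rho> g (\<phi> g x) = 1" using \<rho>(3)[OF g(1)] x by blast
    have "\<rho> g' (\<phi> g x) = 0" if "g' \<in> A - {g}" for g'
      using \<rho>(2)[of g'] that g(1) x by blast
    then have "h (\<phi> g x) = f (\<phi> g x) + \<rho> g (\<phi> g x) * (H g (\<psi> g (\<phi> g x)) - f (\<phi> g x))"
      unfolding h_def using assms(4) g(1) by (subst sum.remove[of A g]) auto
    then have "h (\<phi> g x) \<noteq> 0" using g 1 \<psi>(2)[OF g(1) xX] by simp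
    with g(1) show ?thesis by blast
  qed
  ultimately show ?thesis by blast
qed

section \<open>A generic function vanishes at few points of an orbit\<close>

lemma disjoint_images_neighbourhood:
  assumes "Hausdorff_space X" and "finite A" and "\<And>g. g \<in> A \<Longrightarrow> continuous_map X X (\<phi> g)"
    and "x \<in> topspace X" and "inj_on (\<lambda>g. \<phi> g x) A"
  shows "\<exists>W. openin X W \<and> x \<in> W \<and> disjoint_family_on (\<lambda>g. \<phi> g ` W) A"
proof -
  have pair: "\<exists>W. openin X W \<and> x \<in> W \<and> \<phi> g ` W \<inter> \<phi> h ` W = {}" if "g \<in> A" "h \<in> A" "g \<noteq> h" for g h
  proof -
    have "\<phi> g x \<noteq> \<phi> h x" using assms(5) that by (auto simp: inj_on_def)
    moreover have "\<phi> g x \<in> topspace X" "\<phi> h x \<in> topspace X"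
      using assms(3) that assms(4) continuous_map_image_subset_topspace by blast+
    ultimately obtain U V where UV: "openin X U" "openin X V" "\<phi> g x \<in> U" "\<phi> h x \<in> V" "U \<inter> V = {}"
      using assms(1) unfolding Hausdorff_space_def disjnt_def by metis
    let ?W = "{y \<in> topspace X. \<phi> g y \<in> U} \<inter> {y \<in> topspace X. \<phi> h y \<in> V}"
    have "openin X ?W"
      using assms(3) that UV by (intro openin_Int openin_continuous_map_preimage[of X X]) auto
    then show ?thesis using UV assms(4) by (intro exI[of _ ?W]) auto
  qed
  have "\<forall>p\<in>A \<times> A - Id. \<exists>W. openin X W \<and> x \<in> W \<and> \<phi> (fst p) ` W \<inter> \<phi> (snd p) ` W = {}"
    by (intro ballI pair) auto
  then obtain W where W: "\<forall>p\<in>A \<times> A - Id. openin X (W p) \<and> x \<in> W p \<and> \<phi> (fst p) ` W p \<inter> \<phi> (snd p) ` W p = {}"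
    unfolding bchoice_iff by (elim exE) (rule that)
  let ?V = "(\<Inter>p\<in>A \<times> A - Id. W p) \<inter> topspace X"
  have "openin X ?V" using assms(2) W by (intro openin_INT) auto
  moreover have "disjoint_family_on (\<lambda>g. \<phi> g ` ?V) A"
    unfolding disjoint_family_on_def
  proof (intro ballI impI)
    fix g h assume gh: "g \<in> A" "h \<in> A" "g \<noteq> h"
    then have p: "(g, h) \<in> A \<times> A - Id" by simp
    then have "?V \<subseteq> W (g, h)" by (intro le_infI1 INT_lower)
    moreover have "\<phi> g ` W (g, h) \<inter> \<phi> h ` W (g, h) = {}" using bspec[OF W p] by simp
    ultimately show "\<phi> g ` ?V \<inter> \<phi> h ` ?V = {}"
      using Int_mono[OF image_mono image_mono, of ?V "W (g, h)" ?V "W (g, h)" "\<phi> g" "\<phi> h"] by simp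
  qed
  ultimately show ?thesis using W assms(4) by (intro exI[of _ ?V]) auto
qed

text \<open>A Baire category argument in the complete metric space \<open>C\<close> of continuous real functions
  on \<open>X\<close>. For a set \<open>A\<close> of size \<open>n + 1\<close> and a closed set \<open>K\<close> whose images
  under \<open>A\<close> are disjoint,
  the functions that do not vanish on the whole of any tuple \<open>(\<phi> g x)\<^sub>g\<close> with
  \<open>x \<in> K\<close> form a set that is open, by compactness of \<open>K\<close>, and dense, by the
  approximation lemma for disjoint images. Countably many pairs \<open>(A, K)\<close> suffice to handle
  every point and every tuple of \<open>n + 1\<close> distinct translates of it.\<close>

lemma generic_function_nonvanishing_along_orbits:
  fixes \<phi> :: "'g \<Rightarrow> 'x \<Rightarrow> 'x" and f :: "'x \<Rightarrow> real"
  assumes X: "compact_space X" "metrizable_space X" "covering_dim_le X n"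
    and "countable \<Gamma>" and homeo: "\<And>g. g \<in> \<Gamma> \<Longrightarrow> homeomorphic_map X X (\<phi> g)"
    and f: "continuous_map X euclideanreal f" and "0 < \<epsilon>"
  shows "\<exists>h. continuous_map X euclideanreal h \<and> (\<forall>x\<in>topspace X. \<bar>h x - f x\<bar> < \<epsilon>) \<and>
    (\<forall>x\<in>topspace X. \<forall>A\<subseteq>\<Gamma>. card A = Suc n \<longrightarrow> inj_on (\<lambda>g. \<phi> g x) A \<longrightarrow> (\<exists>g\<in>A. h (\<phi> g x) \<noteq> 0))"
proof -
  define C where "C = cfunspace X (euclidean_metric :: real metric)"
  interpret C: Metric_space "mspace C" "mdist C" by (rule Metric_space_mspace_mdist)
  have "mcomplete_of C"
    unfolding C_def using Met_TC.mcomplete_cfunspace[where ?'a = real, of X] complete_UNIV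
    by (simp add: Met_TC.Self_def euclidean_metric_def)
  then have complete: "C.mcomplete" by (simp add: mcomplete_of_def)
  have compact: "compactin X (topspace X)" using X(1) by (simp add: compact_space_def)
  have C: "h \<in> mspace C \<longleftrightarrow> h \<in> extensional (topspace X) \<and> continuous_map X euclideanreal h" for h
    using compactin_mspace_cfunspace[OF compact, of "euclidean_metric :: real metric"] by (simp add: C_def)
  have restrict_C: "restrict h (topspace X) \<in> mspace C" if "continuous_map X euclideanreal h" for h
    using that by (auto simp: C intro: continuous_map_eq[of _ _ h])
  have near: "\<bar>k x - h x\<bar> < r" if "k \<in> C.mball h r" "x \<in> topspace X" for h k r x
  proof -
    have "h \<in> mspace C" "k \<in> mspace C" "mdist C h k < r" using that(1) by (simp_all add: C.in_mball)
    from cfunspace_mdist_lt[OF compact this[unfolded C_def] that(2)] show ?thesis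
      by (simp add: dist_real_def abs_minus_commute)
  qed
  have \<phi>: "continuous_map X X (\<phi> g)" if "g \<in> \<Gamma>" for g
    using homeo[OF that] by (simp add: homeomorphic_eq_everything_map)
  have \<phi>_in: "\<phi> g x \<in> topspace X" if "g \<in> \<Gamma>" "x \<in> topspace X" for g x
    using \<phi> that continuous_map_image_subset_topspace by blast
  obtain \<K> where \<K>: "countable \<K>" "\<And>K. K \<in> \<K> \<Longrightarrow> closedin X K"
    and nbhd: "\<And>U x. openin X U \<Longrightarrow> x \<in> U \<Longrightarrow> \<exists>K\<in>\<K>. x \<in> K \<and> K \<subseteq> U"
    using compact_metrizable_countable_closed_neighbourhoods[OF X(1,2)] by metis
  define Q where "Q = {(A, K). A \<subseteq> \<Gamma> \<and> card A = Suc n \<and> K \<in> \<K> \<and> disjoint_family_on (\<lambda>g. \<phi> g ` K) A}"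
  define \<O> where "\<O> A K = {h \<in> mspace C. \<forall>x\<in>K. \<exists>g\<in>A. h (\<phi> g x) \<noteq> 0}" for A K
  define \<G> where "\<G> = (\<lambda>(A, K). \<O> A K) ` Q"
  have "countable ({A. A \<subseteq> \<Gamma> \<and> finite A} \<times> \<K>)"
    using countable_Collect_finite_subset[OF assms(4)] \<K>(1) by (intro countable_SIGMA) (auto simp: conj_commute)
  then have "countable Q"
    by (rule countable_subset[rotated]) (auto simp: Q_def intro: card_ge_0_finite)
  then have "countable \<G>" unfolding \<G>_def by (rule countable_image)
  moreover have "openin C.mtopology T \<and> C.mtopology closure_of T = mspace C" if "T \<in> \<G>" for T
  proof -
    obtain A K where T: "T = \<O> A K" and A: "A \<subseteq> \<Gamma>" "card A = Suc n" and K: "K \<in> \<K>"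
      and disj: "disjoint_family_on (\<lambda>g. \<phi> g ` K) A"
      using \<open>T \<in> \<G>\<close> unfolding \<G>_def Q_def by auto
    have fin: "finite A" using A(2) by (intro card_ge_0_finite) simp
    have KX: "K \<subseteq> topspace X" using \<K>(2)[OF K] closedin_subset by blast
    have "\<exists>r>0. C.mball h r \<subseteq> T" if h: "h \<in> T" for h
    proof -
      have hC: "continuous_map X euclideanreal h" using h by (simp add: T \<O>_def C)
      have "continuous_map X euclideanreal (\<lambda>x. h (\<phi> g x))" if "g \<in> A" for g
        using continuous_map_compose[OF \<phi> hC] that A(1) by (auto simp: o_def)
      then have cont: "continuous_map X euclideanreal (\<lambda>x. \<Sum>g\<in>A. \<bar>h (\<phi> g x)\<bar>)"
        using fin by (intro continuous_intros)
      have "0 < (\<Sum>g\<in>A. \<bar>h (\<phi> g x)\<bar>)" if "x \<in> K" for x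
      proof -
        obtain g where "g \<in> A" "h (\<phi> g x) \<noteq> 0" using h \<open>x \<in> K\<close> by (auto simp: T \<O>_def)
        then show ?thesis using fin by (intro sum_pos2[of _ g]) auto
      qed
      then obtain \<delta> where \<delta>: "\<delta> > 0" "\<forall>x\<in>K. \<delta> \<le> (\<Sum>g\<in>A. \<bar>h (\<phi> g x)\<bar>)"
        using compactin_positive_lower_bound[OF closedin_compact_space[OF X(1) \<K>(2)[OF K]] cont] by blast
      \<comment> \<open>If \<open>k\<close> vanished at all \<open>\<phi> g x\<close>, each \<open>\<bar>h (\<phi> g x)\<bar>\<close> would be below \<open>?r\<close> and their sum below \<open>\<delta>\<close>.\<close>
      let ?r = "\<delta> / real (card A)"
      have "k \<in> T" if k: "k \<in> C.mball h ?r" for k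
      proof -
        have "\<exists>g\<in>A. k (\<phi> g x) \<noteq> 0" if x: "x \<in> K" for x
        proof (rule ccontr)
          assume neg: "\<not> ?thesis"
          have "\<bar>h (\<phi> g x)\<bar> < ?r" if "g \<in> A" for g
          proof -
            have "\<phi> g x \<in> topspace X" using \<phi>_in that A(1) x KX by blast
            from near[OF k this] show ?thesis using neg that by simp
          qed
          then have "(\<Sum>g\<in>A. \<bar>h (\<phi> g x)\<bar>) < real (card A) * ?r"
            using A(2) by (intro sum_bounded_above_strict) auto
          also have "\<dots> = \<delta>" using A(2) by simp
          finally show False using \<delta>(2) x by force
        qed
        moreover have "k \<in> mspace C" using k by simp
        ultimately show ?thesis by (simp add: T \<O>_def)
      qed
      moreover have "?r > 0" using \<delta>(1) A(2) by simp
      ultimately show ?thesis by blast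
    qed
    moreover have "T \<subseteq> mspace C" by (auto simp: T \<O>_def)
    ultimately have "openin C.mtopology T" unfolding C.openin_mtopology by blast
    moreover have "\<exists>k\<in>T. k \<in> C.mball h r" if h: "h \<in> mspace C" and r: "r > 0" for h r
    proof -
      have "continuous_map X euclideanreal h" using h by (simp add: C)
      then obtain k where k: "continuous_map X euclideanreal k"
        "\<forall>x\<in>topspace X. \<bar>k x - h x\<bar> < r / 2" "\<forall>x\<in>K. \<exists>g\<in>A. k (\<phi> g x) \<noteq> 0"
        using nonvanishing_along_disjoint_images_approximation[OF X fin A(2) _ \<K>(2)[OF K] disj, of h "r / 2"]
          homeo A(1) r by (auto simp: subset_iff)
      \<comment> \<open>Elements of \<open>C\<close> are \<open>undefined\<close> off the space.\<close>
      let ?k = "restrict k (topspace X)"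
      have "mdist C h ?k \<le> r / 2"
        unfolding C_def using k(2) r
        by (intro mdist_cfunspace_le) (auto simp: dist_real_def abs_minus_commute less_imp_le)
      then have "?k \<in> C.mball h r" using h r restrict_C[OF k(1)] by (simp add: C.in_mball)
      moreover have "\<exists>g\<in>A. ?k (\<phi> g x) \<noteq> 0" if x: "x \<in> K" for x
      proof -
        obtain g where g: "g \<in> A" "k (\<phi> g x) \<noteq> 0" using k(3) x by blast
        then have "\<phi> g x \<in> topspace X" using \<phi>_in A(1) x KX by blast
        with g show ?thesis by (intro bexI[of _ g]) auto
      qed
      ultimately show ?thesis using restrict_C[OF k(1)] unfolding T \<O>_def by blast
    qed
    then have "C.mtopology closure_of T = mspace C" unfolding C.metric_closure_of by blast
    ultimately show ?thesis ..
  qed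
  ultimately have "C.mtopology closure_of \<Inter>\<G> = mspace C"
    using C.metric_Baire_category[OF complete] by blast
  moreover have "restrict f (topspace X) \<in> mspace C" using restrict_C f by blast
  ultimately obtain h where h: "h \<in> \<Inter>\<G>" "h \<in> C.mball (restrict f (topspace X)) \<epsilon>"
    using assms(7) unfolding C.metric_closure_of by blast
  have "continuous_map X euclideanreal h" using h(2) C by (simp add: C.in_mball)
  moreover have "\<bar>h x - f x\<bar> < \<epsilon>" if "x \<in> topspace X" for x
    using near[OF h(2) that] that by simp
  moreover have "\<exists>g\<in>A. h (\<phi> g x) \<noteq> 0"
    if x: "x \<in> topspace X" and A: "A \<subseteq> \<Gamma>" "card A = Suc n" and inj: "inj_on (\<lambda>g. \<phi> g x) A" for x A
  proof -
    have "finite A" using A(2) by (intro card_ge_0_finite) simp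
    then have "\<exists>W. openin X W \<and> x \<in> W \<and> disjoint_family_on (\<lambda>g. \<phi> g ` W) A"
      using \<phi> A(1) X(2) x inj by (intro disjoint_images_neighbourhood metrizable_imp_Hausdorff_space) auto
    then obtain W where W: "openin X W" "x \<in> W" "disjoint_family_on (\<lambda>g. \<phi> g ` W) A"
      by blast
    obtain K where K: "K \<in> \<K>" "x \<in> K" "K \<subseteq> W" using nbhd[OF W(1,2)] by blast
    have "disjoint_family_on (\<lambda>g. \<phi> g ` K) A"
      using W(3) K(3) unfolding disjoint_family_on_def by blast
    then have "\<O> A K \<in> \<G>" using A K(1) by (auto simp: \<G>_def Q_def)
    then have "h \<in> \<O> A K" using h(1) by blast
    then show ?thesis using K(2) by (simp add: \<O>_def)
  qed
  ultimately show ?thesis by blast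
qed

section \<open>Level sets of generic functions are null\<close>

lemma (in prob_space) sum_prob_le_multiplicity:
  assumes "finite A" and "\<And>g. g \<in> A \<Longrightarrow> E g \<in> events"
    and "AE x in M. card {g \<in> A. x \<in> E g} \<le> n"
  shows "(\<Sum>g\<in>A. prob (E g)) \<le> real n"
proof -
  have int: "integrable M (\<lambda>x. indicator (E g) x :: real)" if "g \<in> A" for g
    using assms(2)[OF that] by (simp add: integrable_indicator_iff emeasure_eq_measure)
  have "(\<Sum>g\<in>A. prob (E g)) = (\<Sum>g\<in>A. expectation (indicator (E g)))"
    using assms(2) by (intro sum.cong) auto
  also have "\<dots> = expectation (\<lambda>x. \<Sum>g\<in>A. indicator (E g) x)"
    using int by (simp add: Bochner_Integration.integral_sum)
  also have "\<dots> \<le> expectation (\<lambda>x. real n)"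
  proof (rule integral_mono_AE)
    show "AE x in M. (\<Sum>g\<in>A. indicator (E g) x) \<le> real n"
      using assms(3)
    proof eventually_elim
      case (elim x)
      have "(\<Sum>g\<in>A. indicator (E g) x) = real (card {g \<in> A. x \<in> E g})"
        using assms(1) by (simp add: indicator_def sum.If_cases Int_def)
      with elim show ?case by simp
    qed
  qed (use int in auto)
  finally show ?thesis by (simp add: prob_space)
qed

lemma sets_invariant_prob_measure:
  assumes "\<mu> \<in> invariant_prob_measures G X \<phi>"
  shows "space \<mu> = topspace X" and "openin X U \<Longrightarrow> U \<in> sets \<mu>" and "closedin X K \<Longrightarrow> K \<in> sets \<mu>"
proof -
  have Pow: "{U. openin X U} \<subseteq> Pow (topspace X)" using openin_subset by blast
  have "sets \<mu> = sets (borel_sigma X)" using assms by (simp add: invariant_prob_measures_def)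
  then show sp: "space \<mu> = topspace X" and op: "openin X U \<Longrightarrow> U \<in> sets \<mu>" for U
    using sets_eq_imp_space_eq[of \<mu> "borel_sigma X"] Pow by (auto simp: borel_sigma_def)
  assume "closedin X K"
  then have "topspace X - (topspace X - K) \<in> sets \<mu>" "topspace X - (topspace X - K) = K"
    using sets.compl_sets[OF op[of "topspace X - K"]] sp by (auto simp: closedin_def)
  then show "K \<in> sets \<mu>" by simp
qed

text \<open>Fix \<open>m\<close> group elements. By essential freeness they move almost every point to \<open>m\<close>
  distinct points, and such a point lies in at most \<open>n\<close> of the preimages of the level set
  under them. By invariance these preimages all have the measure of the level set, so \<open>m\<close> times that
  measure is at most \<open>n\<close>. As the group is infinite, \<open>m\<close> is arbitrary.\<close>

lemma level_set_null:
  fixes G (structure)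
  assumes "group G" and "infinite (carrier G)" and "metrizable_space X"
    and act: "continuous_action G X \<phi>" and free: "essentially_free G X \<phi>"
    and \<mu>: "\<mu> \<in> invariant_prob_measures G X \<phi>" and f: "continuous_map X euclideanreal f"
    and mult: "\<And>x A. x \<in> topspace X \<Longrightarrow> A \<subseteq> carrier G \<Longrightarrow> card A = Suc n \<Longrightarrow>
      inj_on (\<lambda>g. \<phi> g x) A \<Longrightarrow> \<exists>g\<in>A. f (\<phi> g x) \<noteq> 0"
  shows "measure \<mu> {x \<in> topspace X. f x = 0} = 0"
proof -
  interpret group G by fact
  interpret group_action G "topspace X" \<phi> using act by (simp add: continuous_action_def)
  interpret prob_space \<mu> using \<mu> by (simp add: invariant_prob_measures_def)
  note sets_\<mu> = sets_invariant_prob_measure[OF \<mu>]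
  have \<phi>: "continuous_map X X (\<phi> g)" if "g \<in> carrier G" for g
    using act that by (simp add: continuous_action_def homeomorphic_eq_everything_map)
  have \<phi>_meas: "\<phi> g \<in> measurable \<mu> \<mu>" if g: "g \<in> carrier G" for g
  proof -
    have "\<phi> g \<in> measurable \<mu> (borel_sigma X)"
      unfolding borel_sigma_def
    proof (rule measurable_measure_of)
      show "\<phi> g \<in> space \<mu> \<rightarrow> topspace X" using g element_image sets_\<mu>(1) by auto
      fix U assume "U \<in> {U. openin X U}"
      then have "openin X {x \<in> topspace X. \<phi> g x \<in> U}"
        using openin_continuous_map_preimage[OF \<phi>[OF g]] by simp
      moreover have "{x \<in> topspace X. \<phi> g x \<in> U} = \<phi> g -` U \<inter> space \<mu>" using sets_\<mu>(1) by auto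
      ultimately show "\<phi> g -` U \<inter> space \<mu> \<in> sets \<mu>" using sets_\<mu>(2) by metis
    qed (use openin_subset in blast)
    moreover have "sets \<mu> = sets (borel_sigma X)" using \<mu> by (simp add: invariant_prob_measures_def)
    ultimately show ?thesis using measurable_cong_sets[OF refl, of \<mu> "borel_sigma X" \<mu>] by blast
  qed
  let ?B = "{x \<in> topspace X. f x = 0}"
  define E where "E g = {x \<in> topspace X. f (\<phi> g x) = 0}" for g
  have "closedin X ?B"
    using closedin_continuous_maps_eq[OF _ f, of "\<lambda>_. 0"] by simp
  then have B: "?B \<in> sets \<mu>" by (rule sets_\<mu>(3))
  have E_eq: "E g = \<phi> g -` ?B \<inter> space \<mu>" if "g \<in> carrier G" for g
    using that element_image sets_\<mu>(1) by (auto simp: E_def)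
  have E_sets: "E g \<in> sets \<mu>" if "g \<in> carrier G" for g
    using E_eq[OF that] measurable_sets[OF \<phi>_meas[OF that] B] by simp
  have E_prob: "prob (E g) = prob ?B" if g: "g \<in> carrier G" for g
  proof -
    have "distr \<mu> \<mu> (\<phi> g) = \<mu>" using \<mu> g by (simp add: invariant_prob_measures_def)
    then show ?thesis using measure_distr[OF \<phi>_meas[OF g] B] E_eq[OF g] by simp
  qed
  \<comment> \<open>Two translates of \<open>x\<close> agree only if \<open>inv h \<otimes> g\<close> fixes \<open>x\<close>.\<close>
  have separated: "AE x in \<mu>. \<phi> g x \<noteq> \<phi> h x" if gh: "g \<in> carrier G" "h \<in> carrier G" "g \<noteq> h" for g h
  proof -
    let ?k = "inv h \<otimes> g"
    have k: "?k \<in> carrier G - {\<one>}" using gh inv_equality inv_inv by (metis DiffI inv_closed m_closed singletonD)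
    let ?D = "{x \<in> topspace X. \<phi> ?k x = x}"
    have "closedin X ?D"
      using closedin_continuous_maps_eq[OF metrizable_imp_Hausdorff_space[OF assms(3)] \<phi>, of ?k id] k
      by simp
    then have "?D \<in> sets \<mu>" by (rule sets_\<mu>(3))
    moreover have "prob ?D = 0" using free k \<mu> by (auto simp: essentially_free_def)
    ultimately have "?D \<in> null_sets \<mu>" by (simp add: null_sets_def emeasure_eq_measure)
    then have "AE x in \<mu>. x \<notin> ?D" by (rule AE_not_in)
    with AE_space show ?thesis
    proof eventually_elim
      case (elim x)
      then have x: "x \<in> topspace X" using sets_\<mu>(1) by simp
      show ?case
      proof
        assume eq: "\<phi> g x = \<phi> h x"
        have "\<phi> ?k x = \<phi> (inv h) (\<phi> h x)" using composition_rule x gh eq by simp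
        also have "\<dots> = x" using orbit_sym_aux[OF gh(2) x] by blast
        finally show False using elim x by simp
      qed
    qed
  qed
  have bound: "real m * prob ?B \<le> real n" for m
  proof -
    obtain A where A: "A \<subseteq> carrier G" "finite A" "card A = m"
      using infinite_arbitrarily_large[OF assms(2)] by metis
    have "AE x in \<mu>. \<forall>g\<in>A. \<forall>h\<in>A. g \<noteq> h \<longrightarrow> \<phi> g x \<noteq> \<phi> h x"
    proof (intro AE_finite_allI A(2))
      fix g h assume "g \<in> A" "h \<in> A"
      then show "AE x in \<mu>. g \<noteq> h \<longrightarrow> \<phi> g x \<noteq> \<phi> h x"
        using separated A(1) by (cases "g = h") auto
    qed
    with AE_space have "AE x in \<mu>. card {g \<in> A. x \<in> E g} \<le> n"
    proof eventually_elim
      case (elim x)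
      then have x: "x \<in> topspace X" using sets_\<mu>(1) by simp
      show ?case
      proof (rule ccontr)
        assume "\<not> ?case"
        then have "Suc n \<le> card {g \<in> A. x \<in> E g}" by simp
        then obtain R where R: "R \<subseteq> {g \<in> A. x \<in> E g}" "card R = Suc n"
          using obtain_subset_with_card_n by metis
        have "inj_on (\<lambda>g. \<phi> g x) R" using elim R(1) by (auto simp: inj_on_def)
        then have "\<exists>g\<in>R. f (\<phi> g x) \<noteq> 0" using mult[OF x _ R(2)] R(1) A(1) by blast
        then show False using R(1) by (auto simp: E_def)
      qed
    qed
    then have "(\<Sum>g\<in>A. prob (E g)) \<le> real n"
      using A E_sets by (intro sum_prob_le_multiplicity) auto
    moreover have "(\<Sum>g\<in>A. prob (E g)) = real m * prob ?B"
      using E_prob A by (subst sum.cong[OF refl, of _ _ "\<lambda>_. prob ?B"]) auto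
    ultimately show ?thesis by simp
  qed
  show ?thesis
  proof (rule ccontr)
    assume "prob ?B \<noteq> 0"
    then have "prob ?B > 0" using zero_less_measure_iff by blast
    then obtain m where "real n < real m * prob ?B" using reals_Archimedean3 by blast
    with bound[of m] show False by simp
  qed
qed

section \<open>The small boundary property\<close>

lemma frontier_of_sublevel_subset:
  fixes f :: "'x \<Rightarrow> real"
  assumes f: "continuous_map X euclideanreal f"
  shows "X frontier_of {x \<in> topspace X. f x < 0} \<subseteq> {x \<in> topspace X. f x = 0}"
proof -
  let ?U = "{x \<in> topspace X. f x \<in> {..<0}}"
  have "openin X ?U"
    using openin_continuous_map_preimage[OF f, of "{..<0}"] by simp
  moreover have "closedin X {x \<in> topspace X. f x \<in> {..0}}"
    using closedin_continuous_map_preimage[OF f, of "{..0}"] by simp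
  then have "X closure_of ?U \<subseteq> {x \<in> topspace X. f x \<in> {..0}}"
    by (rule closure_of_minimal[rotated]) auto
  ultimately show ?thesis by (auto simp: frontier_of_def interior_of_openin)
qed

theorem theorem3:
  fixes G :: "('g, 'b) monoid_scheme"
    and X :: "'x topology"
    and \<phi> :: "'g \<Rightarrow> 'x \<Rightarrow> 'x"
  assumes "group G"
    and "countable (carrier G)"
    and "infinite (carrier G)"
    and "amenable G"
    and "compact_space X"
    and "metrizable_space X"
    and "finite_dimensional_space X"
    and "continuous_action G X \<phi>"
    and "essentially_free G X \<phi>"
  shows "small_boundary_property G X \<phi>"
proof -
  obtain n where n: "covering_dim_le X n"
    using assms(7) by (auto simp: finite_dimensional_space_def)
  have homeo: "\<And>g. g \<in> carrier G \<Longrightarrow> homeomorphic_map X X (\<phi> g)"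
    using assms(8) by (simp add: continuous_action_def)
  obtain M d where "Metric_space M d" and X: "X = Metric_space.mtopology M d"
    using assms(6) unfolding metrizable_space_def by blast
  interpret Metric_space M d by fact
  define \<B> where "\<B> = {U. openin X U \<and> (\<forall>\<mu>\<in>invariant_prob_measures G X \<phi>. measure \<mu> (X frontier_of U) = 0)}"
  have "\<exists>U\<in>\<B>. p \<in> U \<and> U \<subseteq> W" if W: "openin X W" "p \<in> W" for W p
  proof -
    obtain r where r: "r > 0" "mball p r \<subseteq> W" and p: "p \<in> M"
      using W unfolding X openin_mtopology by blast
    \<comment> \<open>Perturbing \<open>d p x - r / 2\<close> by less than \<open>r / 4\<close> keeps it negative at \<open>p\<close> and
    positive outside the ball of radius \<open>r\<close>.\<close>
    have "continuous_map X euclideanreal (\<lambda>x. mdist Self p x)"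
      using p by (intro continuous_map_mdist) (auto simp: X Self_def)
    then have "continuous_map X euclideanreal (\<lambda>x. d p x - r / 2)"
      by (intro continuous_intros) simp_all
    then have "\<exists>f. continuous_map X euclideanreal f \<and> (\<forall>x\<in>topspace X. \<bar>f x - (d p x - r / 2)\<bar> < r / 4) \<and>
        (\<forall>x\<in>topspace X. \<forall>A\<subseteq>carrier G. card A = Suc n \<longrightarrow> inj_on (\<lambda>g. \<phi> g x) A \<longrightarrow>
          (\<exists>g\<in>A. f (\<phi> g x) \<noteq> 0))"
      using r(1) by (intro generic_function_nonvanishing_along_orbits assms(2,5,6) n homeo) auto
    then obtain f where f: "continuous_map X euclideanreal f"
      and near: "\<forall>x\<in>topspace X. \<bar>f x - (d p x - r / 2)\<bar> < r / 4"
      and mult: "\<forall>x\<in>topspace X. \<forall>A\<subseteq>carrier G. card A = Suc n \<longrightarrow> inj_on (\<lambda>g. \<phi> g x) A \<longrightarrow> (\<exists>g\<in>A. f (\<phi> g x) \<noteq> 0)"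
      by (elim exE conjE) (rule that)
    let ?U = "{x \<in> topspace X. f x < 0}"
    have "openin X ?U"
      using openin_continuous_map_preimage[OF f, of "{..<0}"] by simp
    moreover have "measure \<mu> (X frontier_of ?U) = 0" if \<mu>: "\<mu> \<in> invariant_prob_measures G X \<phi>" for \<mu>
    proof -
      interpret prob_space \<mu> using \<mu> by (simp add: invariant_prob_measures_def)
      have "closedin X {x \<in> topspace X. f x = 0}"
        using closedin_continuous_maps_eq[OF _ f, of "\<lambda>_. 0"] by simp
      then have "measure \<mu> (X frontier_of ?U) \<le> measure \<mu> {x \<in> topspace X. f x = 0}"
        using frontier_of_sublevel_subset[OF f] sets_invariant_prob_measure(3)[OF \<mu>]
        by (intro finite_measure_mono) auto
      also have "\<dots> = 0"
        using mult by (intro level_set_null[OF assms(1,3,6,8,9) \<mu> f, of n]) blast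
      finally show ?thesis by (simp add: measure_le_0_iff)
    qed
    moreover have "p \<in> ?U" 
    proof -
      have pX: "p \<in> topspace X" and "d p p = 0" using p by (simp_all add: X)
      then have "f p < 0" using bspec[OF near pX] r(1) by linarith
      with pX show ?thesis by simp
    qed
    moreover have "?U \<subseteq> W"
    proof
      fix x assume x: "x \<in> ?U"
      then have "\<bar>f x - (d p x - r / 2)\<bar> < r / 4" "f x < 0" using bspec[OF near, of x] by simp_all
      then have "d p x < r" using r(1) by linarith
      then show "x \<in> W" using r(2) x p by (auto simp: X)
    qed
    ultimately have "?U \<in> \<B> \<and> p \<in> ?U \<and> ?U \<subseteq> W" by (simp add: \<B>_def)
    then show ?thesis by (intro bexI[of _ ?U]) simp_all
  qed
  then have "openin X = arbitrary union_of (\<lambda>U. U \<in> \<B>)"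
    unfolding openin_topology_base_unique by (auto simp: \<B>_def)
  then show ?thesis unfolding small_boundary_property_def by (intro exI[of _ \<B>]) (auto simp: \<B>_def)
qed

end
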